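(* Let $G$ be a subgroup of $\mathrm{Homeo}^+(\mathbf{R})$. If every nontrivial element of $G$ has precisely one fixed point in $\mathbf{R}$, then $G$ is abelian.
   Context: $\mathrm{Homeo}^+(\mathbf{R})$ denotes the group of orientation-preserving homeomorphisms of the real line $\mathbf{R}$ under composition. *)

theory Defs
  imports "HOL-Analysis.Analysis" "HOL-Algebra.Group"
begin

text \<open>A homeomorphism of the line preserves orientation iff it is increasing.\<close>

definition Homeo_plus_R :: "(real \<Rightarrow> real) monoid" where
  "Homeo_plus_R =
    \<lparr>carrier = {f. (\<exists>g. homeomorphism UNIV UNIV f g) \<and> strict_mono f},
     mult = (\<circ>),
     one = id\<rparr>"

lemma group_Homeo_plus_R: "group Homeo_plus_R"
proof (rule groupI)
  fix f h
  assume "f \<in> carrier Homeo_plus_R" and "h \<in> carrier Homeo_plus_R"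
  then show "f \<otimes>\<^bsub>Homeo_plus_R\<^esub> h \<in> carrier Homeo_plus_R"
    by (auto simp: Homeo_plus_R_def strict_mono_def intro: homeomorphism_compose)
next
  show "\<one>\<^bsub>Homeo_plus_R\<^esub> \<in> carrier Homeo_plus_R"
    using homeomorphism_ident[of "UNIV :: real set"]
    by (auto simp: Homeo_plus_R_def strict_mono_def id_def)
next
  fix f
  assume "f \<in> carrier Homeo_plus_R"
  then obtain g where fg: "homeomorphism UNIV UNIV f g" and f: "strict_mono f"
    by (auto simp: Homeo_plus_R_def)
  have "homeomorphism UNIV UNIV g f"
    using fg by (rule homeomorphism_symD)
  moreover have inverse: "g (f x) = x" "f (g x) = x" for x
    using fg by (auto simp: homeomorphism_def)
  moreover have "strict_mono g"
    using f inverse by (metis strict_mono_def strict_mono_less)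
  ultimately show "\<exists>h\<in>carrier Homeo_plus_R. h \<otimes>\<^bsub>Homeo_plus_R\<^esub> f = \<one>\<^bsub>Homeo_plus_R\<^esub>"
    by (intro bexI[of _ g]) (auto simp: Homeo_plus_R_def)
qed (auto simp: Homeo_plus_R_def comp_assoc)

end

theory Submission
  imports Defs
begin

text \<open>
  The group \<open>G\<close> is ordered by comparing its elements near \<open>+\<infinity>\<close>: put \<open>f \<lhd> g\<close> if \<open>f x < g x\<close> for all
  large \<open>x\<close>. Two distinct elements \<open>f\<close>, \<open>g\<close> agree at precisely one point, namely the fixed point of
  \<open>g\<^sup>-\<^sup>1 \<circ> f\<close>, so beyond that point one of them stays strictly above the other. Hence the order is
  total, and it is clearly invariant under multiplication on both sides.

  The order is Archimedean (\<open>iterates_eventually_exceed\<close>). Let \<open>id \<lhd> f\<close>, let \<open>p\<close> be the fixed point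
  of \<open>f\<close>, and let \<open>g \<in> G\<close>. To the right of \<open>p\<close> the iterates of \<open>f\<close> tend to \<open>+\<infinity>\<close>, so \<open>f\<^sup>n\<close> overtakes
  \<open>g\<close> at \<open>p + 1\<close>; it then stays above \<open>g\<close> provided that the single crossing point of \<open>f\<^sup>n\<close> and \<open>g\<close>
  lies to the left of \<open>p + 1\<close>. There are two ways for this to happen.

  \<^item> If \<open>f\<close> moves the points to the left of \<open>p\<close> down, then \<open>f\<^sup>n (p - 1)\<close> tends to \<open>-\<infinity>\<close>, and
    \<open>f\<^sup>n\<close> crosses \<open>g\<close> between \<open>p - 1\<close> and \<open>p + 1\<close>.
  \<^item> If \<open>f\<close> moves the points to the left of \<open>p\<close> up, then \<open>p\<close> is fixed by all of \<open>G\<close>, and the crossing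
    point is \<open>p\<close>. For otherwise \<open>f\<close> and a conjugate of \<open>f\<close> would both satisfy \<open>x \<le> f x\<close>, with equality
    at different points, and their product would be an element of \<open>G\<close> without fixed points
    (\<open>parabolic_fixed_point_is_global\<close>).

  By Hoelder's theorem, an Archimedean ordered group is abelian.
\<close>

section \<open>Hoelder's theorem\<close>

locale archimedean_ordered_group = group G for G (structure) +
  fixes less :: "'a \<Rightarrow> 'a \<Rightarrow> bool" (infix "\<lhd>" 50)
  assumes irrefl: "x \<in> carrier G \<Longrightarrow> \<not> x \<lhd> x"
    and trans: "\<lbrakk>x \<in> carrier G; y \<in> carrier G; z \<in> carrier G; x \<lhd> y; y \<lhd> z\<rbrakk> \<Longrightarrow> x \<lhd> z"
    and total: "\<lbrakk>x \<in> carrier G; y \<in> carrier G; x \<noteq> y\<rbrakk> \<Longrightarrow> x \<lhd> y \<or> y \<lhd> x"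
    and mult_left_mono:
      "\<lbrakk>x \<in> carrier G; y \<in> carrier G; z \<in> carrier G; x \<lhd> y\<rbrakk> \<Longrightarrow> z \<otimes> x \<lhd> z \<otimes> y"
    and mult_right_mono:
      "\<lbrakk>x \<in> carrier G; y \<in> carrier G; z \<in> carrier G; x \<lhd> y\<rbrakk> \<Longrightarrow> x \<otimes> z \<lhd> y \<otimes> z"
    and archimedean:
      "\<lbrakk>x \<in> carrier G; y \<in> carrier G; \<one> \<lhd> x\<rbrakk> \<Longrightarrow> \<exists>n::nat. y \<lhd> x [^] n"
begin

abbreviation less_eq (infix "\<unlhd>" 50) where
  "x \<unlhd> y \<equiv> x = y \<or> x \<lhd> y"

lemma mult_strict_mono:
  assumes "a \<in> carrier G" "b \<in> carrier G" "c \<in> carrier G" "d \<in> carrier G"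
    and "a \<lhd> b" "c \<lhd> d"
  shows "a \<otimes> c \<lhd> b \<otimes> d"
  using assms mult_left_mono[of c d b] mult_right_mono[of a b c] trans[of "a \<otimes> c" "b \<otimes> c" "b \<otimes> d"]
  by simp

lemma mult_mono:
  assumes "a \<in> carrier G" "b \<in> carrier G" "c \<in> carrier G" "d \<in> carrier G"
    and "a \<unlhd> b" "c \<unlhd> d"
  shows "a \<otimes> c \<unlhd> b \<otimes> d"
  using assms mult_strict_mono mult_left_mono mult_right_mono by metis

lemma less_imp_quotient_positive:
  assumes "x \<in> carrier G" "y \<in> carrier G" "x \<lhd> y"
  shows "\<one> \<lhd> inv x \<otimes> y" and "\<one> \<lhd> y \<otimes> inv x"
  using assms mult_left_mono[of x y "inv x"] mult_right_mono[of x y "inv x"] by simp_all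

lemma between_consecutive_powers:
  assumes "d \<in> carrier G" "a \<in> carrier G" "\<one> \<lhd> d" "\<one> \<lhd> a"
  obtains n :: nat where "d [^] n \<unlhd> a" and "a \<lhd> d [^] Suc n"
proof -
  define n where "n = (LEAST n::nat. a \<lhd> d [^] n)"
  have n: "a \<lhd> d [^] n"
    unfolding n_def using archimedean[OF assms(1,2,3)] by (rule LeastI_ex)
  have "\<not> a \<lhd> \<one>"
    using assms trans[of \<one> a \<one>] irrefl[of \<one>] by auto
  with n have "n \<noteq> 0"
    by (metis nat_pow_0)
  then obtain m where m: "n = Suc m"
    using not0_implies_Suc by blast
  then have "\<not> a \<lhd> d [^] m"
    unfolding n_def using not_less_Least[of m] by (metis lessI)
  then have "d [^] m \<unlhd> a"
    using total[of "d [^] m" a] assms by auto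
  with n m that show thesis
    by blast
qed

text \<open>
  If \<open>\<one> \<lhd> e \<lhd> c\<close>, then \<open>c\<close> is the product of the positive elements \<open>e\<close> and \<open>inv e \<otimes> c\<close>, and the
  square of the smaller of these is at most \<open>c\<close>. So an element without such a ``half'' is the least
  positive element.
\<close>

lemma half_or_least_positive:
  assumes c: "c \<in> carrier G" "\<one> \<lhd> c"
    and no_half: "\<not> (\<exists>d\<in>carrier G. \<one> \<lhd> d \<and> d \<otimes> d \<unlhd> c)"
    and e: "e \<in> carrier G" "\<one> \<lhd> e"
  shows "\<not> e \<lhd> c"
proof
  assume "e \<lhd> c"
  define e' where "e' = inv e \<otimes> c"
  have e': "e' \<in> carrier G" "\<one> \<lhd> e'"
    using c e less_imp_quotient_positive(1)[OF e(1) c(1) \<open>e \<lhd> c\<close>] by (auto simp: e'_def)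
  have prod: "e \<otimes> e' = c"
    using c e by (simp add: e'_def m_assoc[symmetric])
  consider "e \<unlhd> e'" | "e' \<unlhd> e"
    using total[of e e'] e e' by blast
  then show False
  proof cases
    case 1
    then have "e \<otimes> e \<unlhd> c"
      using mult_mono[of e e e e'] e e' prod by auto
    then show False
      using no_half e by blast
  next
    case 2
    then have "e' \<otimes> e' \<unlhd> c"
      using mult_mono[of e' e e' e'] e e' prod by auto
    then show False
      using no_half e' by blast
  qed
qed

text \<open>
  The commutator \<open>c\<close> of \<open>a\<close> and \<open>b\<close> measures how far apart \<open>a \<otimes> b\<close> and \<open>b \<otimes> a\<close> are. If \<open>a\<close> and \<open>b\<close>
  are located with an accuracy of one step of size \<open>d\<close>, then both products are known up to
  \<open>d \<otimes> d\<close>, so a half \<open>d\<close> of \<open>c\<close> cannot exist. Then \<open>c\<close> is the least positive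
  element, \<open>a\<close> and \<open>b\<close> are powers of it, and they commute.
\<close>

lemma positive_not_less_commuted:
  assumes a: "a \<in> carrier G" "\<one> \<lhd> a" and b: "b \<in> carrier G" "\<one> \<lhd> b"
  shows "\<not> b \<otimes> a \<lhd> a \<otimes> b"
proof
  assume less: "b \<otimes> a \<lhd> a \<otimes> b"
  define c where "c = (a \<otimes> b) \<otimes> inv (b \<otimes> a)"
  have c: "c \<in> carrier G" "\<one> \<lhd> c"
    using a b less_imp_quotient_positive(2)[OF _ _ less] by (auto simp: c_def)
  have ab: "a \<otimes> b = c \<otimes> (b \<otimes> a)"
    unfolding c_def using a b by (simp add: m_assoc del: inv_mult_group)
  show False
  proof (cases "\<exists>d\<in>carrier G. \<one> \<lhd> d \<and> d \<otimes> d \<unlhd> c")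
    case True
    then obtain d where d: "d \<in> carrier G" "\<one> \<lhd> d" "d \<otimes> d \<unlhd> c"
      by blast
    obtain m :: nat where m: "d [^] m \<unlhd> a" "a \<lhd> d [^] Suc m"
      using between_consecutive_powers[OF d(1) a(1) d(2) a(2)] .
    obtain n :: nat where n: "d [^] n \<unlhd> b" "b \<lhd> d [^] Suc n"
      using between_consecutive_powers[OF d(1) b(1) d(2) b(2)] .
    have "a \<otimes> b \<lhd> d [^] Suc m \<otimes> d [^] Suc n"
      using mult_strict_mono[OF _ _ _ _ m(2) n(2)] a b d by blast
    also have "d [^] Suc m \<otimes> d [^] Suc n = d [^] (2 + (n + m))"
      using nat_pow_mult[OF d(1), of "Suc m" "Suc n"] by (simp add: ac_simps del: nat_pow_Suc)
    also have "\<dots> = d [^] (2::nat) \<otimes> (d [^] n \<otimes> d [^] m)"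
      using d(1) by (simp add: nat_pow_mult)
    also have "d [^] (2::nat) = d \<otimes> d"
      using d(1) by (simp add: numeral_2_eq_2)
    finally have upper: "a \<otimes> b \<lhd> d \<otimes> d \<otimes> (d [^] n \<otimes> d [^] m)" .
    have "d [^] n \<otimes> d [^] m \<unlhd> b \<otimes> a"
      using mult_mono[OF _ _ _ _ n(1) m(1)] a b d by blast
    then have "d \<otimes> d \<otimes> (d [^] n \<otimes> d [^] m) \<unlhd> c \<otimes> (b \<otimes> a)"
      using mult_mono[of "d \<otimes> d" c "d [^] n \<otimes> d [^] m" "b \<otimes> a"] a b c d by simp
    with upper have "a \<otimes> b \<lhd> c \<otimes> (b \<otimes> a)"
      using trans[OF _ _ _ upper, of "c \<otimes> (b \<otimes> a)"] a b c d
      by (metis m_closed nat_pow_closed)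
    then show False
      using irrefl[of "a \<otimes> b"] a b unfolding ab[symmetric] by blast
  next
    case False
    have power_of_c: "\<exists>n::nat. x = c [^] n" if x: "x \<in> carrier G" "\<one> \<lhd> x" for x
    proof -
      obtain n :: nat where n: "c [^] n \<unlhd> x" "x \<lhd> c [^] Suc n"
        using between_consecutive_powers[OF c(1) x(1) c(2) x(2)] .
      \<comment> \<open>The remainder of \<open>x\<close> on division by \<open>c\<close> is smaller than \<open>c\<close>, so it cannot be positive.\<close>
      define e where "e = inv (c [^] n) \<otimes> x"
      have e: "e \<in> carrier G"
        using c x by (simp add: e_def)
      have "e \<lhd> inv (c [^] n) \<otimes> c [^] Suc n"
        unfolding e_def using mult_left_mono[OF _ _ _ n(2)] c x by blast
      then have "e \<lhd> c"
        using c by (simp add: m_assoc[symmetric])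
      then have "\<not> \<one> \<lhd> e"
        using half_or_least_positive[OF c False e] by blast
      then have "\<not> c [^] n \<lhd> x"
        using less_imp_quotient_positive(1) c x by (auto simp: e_def)
      with n show ?thesis
        by blast
    qed
    obtain m n :: nat where "a = c [^] m" "b = c [^] n"
      using power_of_c a b by blast
    then have "a \<otimes> b = b \<otimes> a"
      using c by (simp add: nat_pow_mult add.commute)
    then show False
      using less irrefl a b by simp
  qed
qed

lemma positive_commute:
  assumes "a \<in> carrier G" "\<one> \<lhd> a" "b \<in> carrier G" "\<one> \<lhd> b"
  shows "a \<otimes> b = b \<otimes> a"
  using assms positive_not_less_commuted[of a b] positive_not_less_commuted[of b a]
    total[of "a \<otimes> b" "b \<otimes> a"] by auto

lemma commute_if_inv_commutes:
  assumes x: "x \<in> carrier G" and y: "y \<in> carrier G" and comm: "inv x \<otimes> y = y \<otimes> inv x"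
  shows "x \<otimes> y = y \<otimes> x"
proof -
  have "x \<otimes> y = x \<otimes> (y \<otimes> inv x) \<otimes> x"
    using x y by (simp add: m_assoc)
  also have "\<dots> = x \<otimes> (inv x \<otimes> y) \<otimes> x"
    by (simp add: comm)
  also have "\<dots> = y \<otimes> x"
    using x y by (simp add: m_assoc[symmetric])
  finally show ?thesis .
qed

lemma positive_or_inv_positive:
  assumes "x \<in> carrier G" "x \<noteq> \<one>"
  shows "\<one> \<lhd> x \<or> \<one> \<lhd> inv x"
  using assms total[of x \<one>] less_imp_quotient_positive(1)[of x \<one>] by auto

theorem abelian: "comm_group G"
proof (rule group_comm_groupI)
  fix x y
  assume x: "x \<in> carrier G" and y: "y \<in> carrier G"
  have positive_left: "a \<otimes> b = b \<otimes> a"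
    if a: "a \<in> carrier G" "\<one> \<lhd> a" and b: "b \<in> carrier G" for a b
  proof (cases "b = \<one>")
    case False
    then show ?thesis
      using positive_or_inv_positive[OF b] positive_commute[OF a]
        commute_if_inv_commutes[OF b a(1)] b by (metis inv_closed)
  qed (use a in simp)
  show "x \<otimes> y = y \<otimes> x"
  proof (cases "x = \<one>")
    case False
    then show ?thesis
      using positive_or_inv_positive[OF x] positive_left x y commute_if_inv_commutes[OF x y]
      by (metis inv_closed)
  qed (use y in simp)
qed

end

section \<open>Continuous functions that do not meet\<close>

lemma less_on_connected:
  fixes f g :: "'a::topological_space \<Rightarrow> real"
  assumes S: "connected S" and cont: "continuous_on S f" "continuous_on S g"
    and neq: "\<And>x. x \<in> S \<Longrightarrow> f x \<noteq> g x"
    and y: "y \<in> S" "f y < g y" and x: "x \<in> S"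
  shows "f x < g x"
proof (rule ccontr)
  assume "\<not> f x < g x"
  have "connected ((\<lambda>x. f x - g x) ` S)"
    using S cont by (intro connected_continuous_image continuous_intros)
  then have "0 \<in> (\<lambda>x. f x - g x) ` S"
    by (rule connectedD_interval[of _ "f y - g y" "f x - g x"])
      (use \<open>\<not> f x < g x\<close> x y in auto)
  then show False
    using neq by auto
qed

text \<open>A bounded orbit would increase to a fixed point.\<close>

lemma iterates_tendsto_at_top:
  fixes f :: "real \<Rightarrow> real"
  assumes cont: "continuous_on UNIV f" and up: "\<And>y. x \<le> y \<Longrightarrow> y < f y"
  shows "filterlim (\<lambda>n. (f ^^ n) x) at_top sequentially"
proof -
  let ?u = "\<lambda>n. (f ^^ n) x"
  have ge: "x \<le> ?u n" for n
    by (induction n) (auto intro: order.trans less_imp_le[OF up])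
  then have inc: "incseq ?u"
    by (intro incseq_SucI) (auto intro: less_imp_le[OF up])
  have unbounded: "\<exists>n. M < ?u n" for M
  proof (rule ccontr)
    assume "\<not> (\<exists>n. M < ?u n)"
    then have "\<forall>n. ?u n \<le> M"
      by (simp add: not_less)
    with inc obtain L where L: "?u \<longlonglongrightarrow> L"
      using incseq_convergent by blast
    have "(\<lambda>n. f (?u n)) \<longlonglongrightarrow> f L"
      using cont L by (auto intro: continuous_on_tendsto_compose)
    moreover have "(\<lambda>n. f (?u n)) \<longlonglongrightarrow> L"
      using LIMSEQ_Suc[OF L] by simp
    ultimately have "f L = L"
      by (rule LIMSEQ_unique)
    moreover have "x \<le> L"
      using L ge by (intro LIMSEQ_le_const) auto
    ultimately show False
      using up[of L] by simp
  qed
  show ?thesis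
    unfolding filterlim_at_top eventually_sequentially
  proof
    fix Z
    obtain n where "Z < ?u n"
      using unbounded by blast
    then show "\<exists>N. \<forall>n\<ge>N. Z \<le> ?u n"
      using incseqD[OF inc] by (meson less_imp_le order.trans)
  qed
qed

lemma iterates_tendsto_at_bot:
  fixes f :: "real \<Rightarrow> real"
  assumes cont: "continuous_on UNIV f" and down: "\<And>y. y \<le> x \<Longrightarrow> f y < y"
  shows "filterlim (\<lambda>n. (f ^^ n) x) at_bot sequentially"
proof -
  \<comment> \<open>Conjugation by the reflection at \<open>0\<close> exchanges the two ends of the line.\<close>
  define h where "h = (\<lambda>y. - f (- y))"
  have "(h ^^ n) (- x) = - ((f ^^ n) x)" for n
    by (induction n) (simp_all add: h_def)
  moreover have "filterlim (\<lambda>n. (h ^^ n) (- x)) at_top sequentially"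
  proof (rule iterates_tendsto_at_top)
    show "continuous_on UNIV h"
      unfolding h_def
      by (intro continuous_intros continuous_on_compose2[OF cont]) auto
    show "y < h y" if "- x \<le> y" for y
      using down[of "- y"] that by (simp add: h_def)
  qed
  ultimately show ?thesis
    by (simp add: filterlim_uminus_at_bot)
qed

section \<open>Groups whose nontrivial elements have a single fixed point\<close>

locale single_fixed_point_group =
  fixes G :: "(real \<Rightarrow> real) set"
  assumes subgroup: "subgroup G Homeo_plus_R"
    and single_fixed_point: "\<And>g. g \<in> G \<Longrightarrow> g \<noteq> id \<Longrightarrow> \<exists>!x. g x = x"
begin

lemma elements:
  assumes "f \<in> G"
  shows element_continuous: "continuous_on S f"
    and element_strict_mono: "strict_mono f"
    and element_surj: "surj f"
proof -
  have "f \<in> carrier Homeo_plus_R"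
    using subgroup assms subgroup.subset by blast
  then obtain g where g: "homeomorphism UNIV UNIV f g" and "strict_mono f"
    by (auto simp: Homeo_plus_R_def)
  then show "continuous_on S f" "strict_mono f" "surj f"
    by (auto simp: homeomorphism_def intro: continuous_on_subset)
qed

lemma element_at_top:
  assumes "f \<in> G"
  shows "filterlim f at_top at_top"
  unfolding filterlim_at_top_dense
proof
  fix Z
  obtain z where z: "f z = Z"
    using element_surj[OF assms] by (metis surjD)
  show "\<forall>\<^sub>F x in at_top. Z < f x"
    using eventually_gt_at_top[of z]
    by eventually_elim (use z element_strict_mono[OF assms] in \<open>auto simp: strict_mono_def\<close>)
qed

lemma compose_in: "f \<in> G \<Longrightarrow> g \<in> G \<Longrightarrow> f \<circ> g \<in> G"
  using subgroup.m_closed[OF subgroup] by (simp add: Homeo_plus_R_def)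

lemma id_in: "id \<in> G"
  using subgroup.one_closed[OF subgroup] by (simp add: Homeo_plus_R_def)

lemma inverse_in:
  assumes "f \<in> G"
  obtains g where "g \<in> G" and "\<And>x. g (f x) = x" and "\<And>x. f (g x) = x"
proof -
  let ?g = "inv\<^bsub>Homeo_plus_R\<^esub> f"
  have f: "f \<in> carrier Homeo_plus_R"
    using subgroup assms subgroup.subset by blast
  have "?g \<circ> f = id" "f \<circ> ?g = id"
    using group.l_inv[OF group_Homeo_plus_R f] group.r_inv[OF group_Homeo_plus_R f]
    by (simp_all add: Homeo_plus_R_def)
  then show thesis
    using that[of ?g] subgroup.m_inv_closed[OF subgroup assms] by (auto simp: fun_eq_iff)
qed

lemma iterate_in: "f \<in> G \<Longrightarrow> f ^^ n \<in> G"
  by (induction n) (auto intro: id_in compose_in)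

lemma single_crossing:
  assumes f: "f \<in> G" and g: "g \<in> G" and "f \<noteq> g"
  shows "\<exists>!x. f x = g x"
proof -
  obtain h where h: "h \<in> G" "\<And>x. h (g x) = x" "\<And>x. g (h x) = x"
    using inverse_in[OF g] by metis
  have crossing: "(h \<circ> f) x = x \<longleftrightarrow> f x = g x" for x
    using h by (metis comp_apply)
  then have "h \<circ> f \<noteq> id"
    using \<open>f \<noteq> g\<close> by (metis ext id_apply)
  then have "\<exists>!x. (h \<circ> f) x = x"
    using single_fixed_point compose_in[OF h(1) f] by blast
  then show ?thesis
    unfolding crossing .
qed

lemma less_right_of_crossing:
  assumes "f \<in> G" "g \<in> G" and p: "f p = g p" and y: "p < y" "f y < g y" and x: "p < x"
  shows "f x < g x"
proof (rule less_on_connected[of "{p<..}" f g y x])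
  have "f \<noteq> g"
    using y by auto
  then show "f x \<noteq> g x" if "x \<in> {p<..}" for x
    using single_crossing[OF assms(1,2)] p that by auto
qed (use assms element_continuous in auto)

text \<open>
  Call \<open>f\<close> parabolic at \<open>p\<close> if it moves all points except \<open>p\<close> to the right. If \<open>g\<close> moves \<open>p\<close>, then
  the conjugate of \<open>f\<close> by \<open>g\<close> is parabolic at a different point, and composing the two moves every
  point to the right.
\<close>

lemma parabolic_fixed_point_is_global:
  assumes f: "f \<in> G" and fixed: "f p = p" and right: "\<And>x. x \<noteq> p \<Longrightarrow> x < f x" and g: "g \<in> G"
  shows "g p = p"
proof (rule ccontr)
  assume "g p \<noteq> p"
  obtain h where h: "h \<in> G" "\<And>x. h (g x) = x" "\<And>x. g (h x) = x"
    using inverse_in[OF g] by metis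
  define k where "k = f \<circ> (g \<circ> (f \<circ> h))"
  have "k \<in> G"
    unfolding k_def using f g h by (intro compose_in)
  have "x < k x" for x
  proof (cases "h x = p")
    case True
    then have "x = g p"
      using h(3) by metis
    then show ?thesis
      using right[of "g p"] \<open>g p \<noteq> p\<close> fixed h by (simp add: k_def)
  next
    case False
    then have "g (h x) < g (f (h x))"
      using right element_strict_mono[OF g] by (simp add: strict_mono_def)
    then have "x < g (f (h x))"
      using h by simp
    also have "\<dots> \<le> k x"
      using right[of "g (f (h x))"] fixed by (cases "g (f (h x)) = p") (auto simp: k_def)
    finally show ?thesis .
  qed
  then have "k x \<noteq> x" for x
    by (metis less_irrefl)
  then show False
    using single_fixed_point[OF \<open>k \<in> G\<close>] by (metis id_apply)
qed

definition eventually_less :: "(real \<Rightarrow> real) \<Rightarrow> (real \<Rightarrow> real) \<Rightarrow> bool" where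
  "eventually_less f g \<longleftrightarrow> (\<forall>\<^sub>F x in at_top. f x < g x)"

lemma eventually_less_if_beyond_crossing:
  assumes "f \<in> G" "g \<in> G" "f p = g p" "p < y" "f y < g y"
  shows "eventually_less f g"
  unfolding eventually_less_def
  using eventually_gt_at_top[of p] by eventually_elim (rule less_right_of_crossing[OF assms])

lemma eventually_less_total:
  assumes "f \<in> G" "g \<in> G" "f \<noteq> g"
  shows "eventually_less f g \<or> eventually_less g f"
proof -
  obtain p where p: "f p = g p" "\<And>x. f x = g x \<Longrightarrow> x = p"
    using single_crossing[OF assms] by blast
  have "f (p + 1) \<noteq> g (p + 1)"
    using p(2)[of "p + 1"] by auto
  then consider "f (p + 1) < g (p + 1)" | "g (p + 1) < f (p + 1)"
    by linarith
  then show ?thesis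
    using eventually_less_if_beyond_crossing[of f g p "p + 1"]
      eventually_less_if_beyond_crossing[of g f p "p + 1"] assms p(1) by cases auto
qed

lemma iterates_eventually_exceed:
  assumes f: "f \<in> G" and pos: "eventually_less id f" and g: "g \<in> G"
  shows "\<exists>n. eventually_less g (f ^^ n)"
proof -
  have "f \<noteq> id"
    using pos by (auto simp: eventually_less_def)
  then obtain p where p: "f p = p" and moved: "\<And>x. x \<noteq> p \<Longrightarrow> f x \<noteq> x"
    using single_fixed_point[OF f] by blast
  obtain y where y: "p < y" "y < f y"
    using eventually_conj[OF eventually_gt_at_top[of p] pos[unfolded eventually_less_def]]
    by (auto dest: eventually_happens)
  have up: "x < f x" if "p < x" for x
    using less_right_of_crossing[OF id_in f, of p y x] p y that by (metis id_apply)
  have "filterlim (\<lambda>n. (f ^^ n) (p + 1)) at_top sequentially"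
    using up by (intro iterates_tendsto_at_top element_continuous[OF f]) auto
  then have overtake: "\<forall>\<^sub>F n in sequentially. g (p + 1) < (f ^^ n) (p + 1)"
    by (simp add: filterlim_at_top_dense)
  show ?thesis
  proof (cases "f (p - 1) < p - 1")
    case True
    have down: "f x < x" if "x < p" for x
      by (rule less_on_connected[of "{..<p}" f "\<lambda>x. x" "p - 1" x])
        (use True moved that element_continuous[OF f] in \<open>auto simp: continuous_on_id\<close>)
    have "filterlim (\<lambda>n. (f ^^ n) (p - 1)) at_bot sequentially"
      using down by (intro iterates_tendsto_at_bot element_continuous[OF f]) auto
    then have "\<forall>\<^sub>F n in sequentially. (f ^^ n) (p - 1) < g (p - 1)"
      by (simp add: filterlim_at_bot_dense)
    from eventually_conj[OF overtake this]
    obtain n where n: "g (p + 1) < (f ^^ n) (p + 1)" "(f ^^ n) (p - 1) < g (p - 1)"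
      by (auto dest: eventually_happens)
    have fn: "f ^^ n \<in> G"
      using f by (rule iterate_in)
    obtain q where q: "g q = (f ^^ n) q" "q \<in> {p - 1..p + 1}"
      using less_on_connected[of "{p - 1..p + 1}" "f ^^ n" g "p - 1" "p + 1"] n
        element_continuous[OF fn] element_continuous[OF g] by force
    with n have "q < p + 1"
      by (cases "q = p + 1") auto
    then show ?thesis
      using eventually_less_if_beyond_crossing[OF g fn q(1) _ n(1)] by blast
  next
    case False
    have "p - 1 < f (p - 1)"
      using False moved[of "p - 1"] by linarith
    have neq: "x \<noteq> f x" if "x < p" for x
      using moved[of x] that by simp
    have "x < f x" if "x < p" for x
      by (rule less_on_connected[of "{..<p}" "\<lambda>x. x" f "p - 1" x])
        (use \<open>p - 1 < f (p - 1)\<close> neq that element_continuous[OF f] in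
          \<open>auto simp: continuous_on_id\<close>)
    with up have right: "x < f x" if "x \<noteq> p" for x
      using that by (meson linorder_neqE)
    have global: "k p = p" if "k \<in> G" for k
      using parabolic_fixed_point_is_global[OF f p(1) right that] .
    obtain n where "g (p + 1) < (f ^^ n) (p + 1)"
      using overtake by (auto dest: eventually_happens)
    moreover have "g p = (f ^^ n) p"
      using global[OF g] global[OF iterate_in[OF f, of n]] by simp
    ultimately show ?thesis
      using eventually_less_if_beyond_crossing[OF g iterate_in[OF f, of n], of p "p + 1"] by auto
  qed
qed

lemma comm_group: "comm_group (Homeo_plus_R\<lparr>carrier := G\<rparr>)"
proof -
  let ?H = "Homeo_plus_R\<lparr>carrier := G\<rparr>"
  have sel: "carrier ?H = G" "\<one>\<^bsub>?H\<^esub> = id" "\<And>f g. f \<otimes>\<^bsub>?H\<^esub> g = f \<circ> g"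
    by (simp_all add: Homeo_plus_R_def)
  interpret H: group ?H
    using group.subgroup_imp_group[OF group_Homeo_plus_R subgroup] .
  have power: "f [^]\<^bsub>?H\<^esub> n = f ^^ n" for f and n :: nat
  proof (induction n)
    case 0
    show ?case
      by (simp only: H.nat_pow_0 sel funpow_0 funpow.simps(1))
  next
    case (Suc n)
    then show ?case
      by (simp only: H.nat_pow_Suc sel funpow_Suc_right)
  qed
  interpret archimedean_ordered_group ?H eventually_less
  proof (intro archimedean_ordered_group.intro archimedean_ordered_group_axioms.intro H.group_axioms;
      unfold sel power)
    fix f
    show "\<not> eventually_less f f"
      by (simp add: eventually_less_def)
  next
    fix f g h
    assume "eventually_less f g" "eventually_less g h"
    then show "eventually_less f h"
      unfolding eventually_less_def by eventually_elim simp
  next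
    fix f g
    assume "f \<in> G" "g \<in> G" "f \<noteq> g"
    then show "eventually_less f g \<or> eventually_less g f"
      by (rule eventually_less_total)
  next
    fix f g h
    assume h: "h \<in> G" and "eventually_less f g"
    then show "eventually_less (h \<circ> f) (h \<circ> g)"
      by (simp add: eventually_less_def strict_mono_less[OF element_strict_mono[OF h]])
  next
    fix f g h
    assume "h \<in> G" "eventually_less f g"
    then show "eventually_less (f \<circ> h) (g \<circ> h)"
      using eventually_compose_filterlim[OF _ element_at_top[of h], of "\<lambda>x. f x < g x"]
      unfolding eventually_less_def by simp
  next
    fix f g
    assume "f \<in> G" "g \<in> G" "eventually_less id f"
    then show "\<exists>n. eventually_less g (f ^^ n)"
      using iterates_eventually_exceed by blast
  qed
  show ?thesis
    by (rule abelian)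
qed

end

theorem theorem1p2:
  fixes G :: "(real \<Rightarrow> real) set"
  assumes "subgroup G Homeo_plus_R"
    and "\<forall>g\<in>G. g \<noteq> \<one>\<^bsub>Homeo_plus_R\<^esub> \<longrightarrow> (\<exists>!x. g x = x)"
  shows "comm_group (Homeo_plus_R\<lparr>carrier := G\<rparr>)"
proof -
  have "single_fixed_point_group G"
  proof (rule single_fixed_point_group.intro)
    show "subgroup G Homeo_plus_R"
      by (rule assms(1))
    show "\<exists>!x. g x = x" if "g \<in> G" "g \<noteq> id" for g
      using assms(2) that by (simp add: Homeo_plus_R_def)
  qed
  then show ?thesis
    by (rule single_fixed_point_group.comm_group)
qed

end
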